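(* Let $\mathbb{F}$ be any field, let $R$ be a regular subgroup of $\mathrm{AGL}_n(\mathbb{F})$ and let $1\neq z$ be an element of the center $Z(R)$ of $R$. Then, up to conjugation of $R$ under $\mathrm{AGL}_n(\mathbb{F})$, we may suppose that $z=J_z$, where $J_z=\mathrm{diag}(J_{n_1},\dots,J_{n_k})$ is the Jordan form of $z$ having Jordan blocks of respective sizes $n_i\ge n_{i+1}$ for all $i\ge 1$. That is, there exists $g\in\mathrm{AGL}_n(\mathbb{F})$ such that $g^{-1}zg=J_z$.
   Context: $\mathrm{AGL}_n(\mathbb{F})$ is the subgroup of $\mathrm{GL}_{n+1}(\mathbb{F})$ consisting of the matrices with first column $(1,0,\dots,0)^{\mathrm T}$. A subgroup $R\le\mathrm{AGL}_n(\mathbb{F})$ is regular if for every $v\in\mathbb{F}^n$ there is exactly one element of $R$ with first row $(1,v)$. The center of a regular subgroup is unipotent, so $z$ has a unipotent Jordan form; here $J_m$ denotes the $m\times m$ unipotent Jordan block with $1$'s on the main diagonal and on the diagonal above it, and $0$'s elsewhere. *)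

theory Defs
  imports "HOL-Algebra.Coset" "Jordan_Normal_Form.Jordan_Normal_Form"
begin

definition GL :: "nat \<Rightarrow> 'a :: field mat monoid" where
  "GL n = units_of (ring_mat TYPE('a) n ())"

(* Matrices are indexed from 0 and act on row vectors from the right, so the affine point
   v of F^n is the row vector (1,v) of length Suc n. *)
definition AGL :: "nat \<Rightarrow> 'a :: field mat monoid" where
  "AGL n = GL (Suc n)\<lparr>carrier := {A \<in> carrier (GL (Suc n)). col A 0 = unit_vec (Suc n) 0}\<rparr>"

lemma group_GL: "group (GL n :: 'a :: field mat monoid)"
proof -
  interpret semiring "ring_mat TYPE('a) n ()" by (rule semiring_mat)
  show ?thesis unfolding GL_def by (rule units_group)
qed

lemma GL_simps:
  "monoid.mult (GL n :: 'a :: field mat monoid) = (*)"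
  "one (GL n :: 'a mat monoid) = 1\<^sub>m n"
  by (simp_all add: GL_def units_of_def ring_mat_simps)

lemma AGL_simps:
  "monoid.mult (AGL n :: 'a :: field mat monoid) = (*)"
  "one (AGL n :: 'a mat monoid) = 1\<^sub>m (Suc n)"
  by (simp_all add: AGL_def GL_simps)

lemma GL_carrier_mat: "A \<in> carrier (GL n) \<Longrightarrow> A \<in> carrier_mat n n"
  by (auto simp: GL_def units_of_def Units_def ring_mat_simps)

lemma subgroup_AGL_GL: "subgroup (carrier (AGL n)) (GL (Suc n) :: 'a :: field mat monoid)"
proof -
  let ?G = "GL (Suc n) :: 'a mat monoid"
  let ?e = "unit_vec (Suc n) 0 :: 'a vec"
  interpret group ?G by (rule group_GL)
  have car: "carrier (AGL n) = {A \<in> carrier ?G. col A 0 = ?e}" by (simp add: AGL_def)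
  have col: "col A 0 = A *\<^sub>v ?e" if "A \<in> carrier_mat (Suc n) (Suc n)" for A
    using that by (intro eq_vecI) auto
  show ?thesis unfolding car
  proof (rule subgroupI)
    show "{A \<in> carrier ?G. col A 0 = ?e} \<noteq> {}"
      using one_closed by (force simp: GL_simps)
  next
    fix A assume A: "A \<in> {A \<in> carrier ?G. col A 0 = ?e}"
    then have AG: "A \<in> carrier ?G" and Ae: "col A 0 = ?e" by auto
    let ?B = "inv\<^bsub>?G\<^esub> A"
    have BG: "?B \<in> carrier ?G" using AG by simp
    note Am = GL_carrier_mat[OF AG] and Bm = GL_carrier_mat[OF BG]
    have "?B *\<^sub>v ?e = ?B *\<^sub>v (A *\<^sub>v ?e)" using Ae col[OF Am] by simp
    also have "\<dots> = (?B * A) *\<^sub>v ?e" using Am Bm by simp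
    also have "?B * A = 1\<^sub>m (Suc n)" using l_inv[OF AG] by (simp add: GL_simps)
    finally show "?B \<in> {A \<in> carrier ?G. col A 0 = ?e}" using BG col[OF Bm] by simp
  next
    fix A B assume "A \<in> {A \<in> carrier ?G. col A 0 = ?e}" "B \<in> {A \<in> carrier ?G. col A 0 = ?e}"
    then have AG: "A \<in> carrier ?G" and Ae: "col A 0 = ?e"
      and BG: "B \<in> carrier ?G" and Be: "col B 0 = ?e" by auto
    note Am = GL_carrier_mat[OF AG] and Bm = GL_carrier_mat[OF BG]
    have "(A * B) *\<^sub>v ?e = A *\<^sub>v (B *\<^sub>v ?e)" using Am Bm by simp
    also have "\<dots> = ?e" using Ae Be col[OF Am] col[OF Bm] by simp
    finally show "A \<otimes>\<^bsub>?G\<^esub> B \<in> {A \<in> carrier ?G. col A 0 = ?e}"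
      using m_closed[OF AG BG] col[of "A * B"] Am Bm by (simp add: GL_simps)
  qed auto
qed

lemma group_AGL: "group (AGL n :: 'a :: field mat monoid)"
proof -
  have "AGL n = (GL (Suc n) :: 'a mat monoid)\<lparr>carrier := carrier (AGL n)\<rparr>"
    by (simp add: AGL_def)
  then show ?thesis
    using subgroup.subgroup_is_group[OF subgroup_AGL_GL group_GL] by metis
qed

definition regular_subgroup :: "nat \<Rightarrow> 'a :: field mat set \<Rightarrow> bool" where
  "regular_subgroup n R \<longleftrightarrow>
     subgroup R (AGL n) \<and> (\<forall>v \<in> carrier_vec n. \<exists>!r. r \<in> R \<and> row r 0 = vCons 1 v)"

definition center :: "('a, 'b) monoid_scheme \<Rightarrow> 'a set" where
  "center G = {x \<in> carrier G. \<forall>y \<in> carrier G. x \<otimes>\<^bsub>G\<^esub> y = y \<otimes>\<^bsub>G\<^esub> x}"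

(* The matrix diag(J_{n_1},...,J_{n_k}) for ns = [n_1,...,n_k]. *)
definition unipotent_jordan_matrix :: "nat list \<Rightarrow> 'a :: field mat" where
  "unipotent_jordan_matrix ns = jordan_matrix (map (\<lambda>m. (m, 1)) ns)"

(* The Jordan form of z is diag(J_{n_1},...,J_{n_k}) with n_1 >= ... >= n_k >= 1; positivity
   of the block sizes is part of jordan_nf. *)
definition unipotent_jordan_form :: "'a :: field mat \<Rightarrow> nat list \<Rightarrow> bool" where
  "unipotent_jordan_form z ns \<longleftrightarrow>
     sorted_wrt (\<ge>) ns \<and> jordan_nf z (map (\<lambda>m. (m, 1)) ns)"

end

theory Submission
  imports Defs
begin

text \<open>
  Let \<open>N = z - 1\<close>, with affine points acted on as row vectors; let \<open>e\<close> be the zeroth unit column and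
  \<open>h\<close> the zeroth coordinate functional on rows, so that \<open>N e = 0\<close>. As \<open>R\<close> is transitive on the rows
  with \<open>h = 1\<close>, which span the space, and commutes with \<open>N\<close>, a power of \<open>N\<close> that kills one row with
  \<open>h \<noteq> 0\<close> is zero. A linear relation among the iterates of \<open>(1, 0)\<close> yields such a row, so \<open>N\<close> is
  nilpotent, say of index \<open>m\<close>.
  Moreover \<open>h\<close> vanishes on the left kernel of \<open>N\<^sup>m\<^sup>-\<^sup>1\<close>, hence \<open>e = N\<^sup>m\<^sup>-\<^sup>1 p\<close> for some column \<open>p\<close>.
  The columns \<open>N\<^sup>m\<^sup>-\<^sup>1 p, \<dots>, N p, p\<close> span a Jordan block of maximal size whose first vector
  is \<open>e\<close>. It splits off with an \<open>N\<close>-invariant complement, to which the same splitting is applied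
  recursively; the blocks come out in decreasing order, and the base change fixes \<open>e\<close>, i.e. is affine.
\<close>

subsection \<open>Row reduction\<close>

text \<open>For the reduced echelon form \<open>E = P * K\<close> such an inverse \<open>F\<close>
  can be read off the pivots, and \<open>F * P\<close> then serves for \<open>K\<close>. The purpose
  is to solve \<open>K p = e\<close>: whenever this is solvable, \<open>p = L e\<close> is a
  solution.\<close>

lemma generalized_inverse_exists:
  fixes K :: "'a :: field mat"
  assumes K: "K \<in> carrier_mat nr nc"
  shows "\<exists>L \<in> carrier_mat nc nr. K * L * K = K"
proof -
  define E where "E = gauss_jordan_single K"
  note gj = gauss_jordan_single[OF K E_def[symmetric]]
  have E: "E \<in> carrier_mat nr nc" by (rule gj(2))
  obtain P Q where P: "P \<in> carrier_mat nr nr" and Q: "Q \<in> carrier_mat nr nr"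
    and QP: "Q * P = 1\<^sub>m nr" and EPK: "E = P * K"
    using gj(4) by blast
  obtain f where "pivot_fun E f (dim_col E)"
    using gj(3) unfolding row_echelon_form_def by blast
  then have piv: "pivot_fun E f nc" using E by simp
  note pD = pivot_funD[OF carrier_matD(1)[OF E] piv]
  \<comment> \<open>Column \<open>k\<close> of \<open>F\<close> is the unit vector at the pivot
    position \<open>f k\<close>. A zero row of \<open>E\<close> has \<open>f k = nc\<close>, which
    is out of range, so its column in \<open>F\<close> is zero. Hence \<open>E * F\<close> is the
    projection onto the coordinates of the nonzero rows, and it fixes \<open>E\<close>.\<close>
  define F :: "'a mat" where "F = mat nc nr (\<lambda>(j, k). if j = f k then 1 else 0)"
  have F: "F \<in> carrier_mat nc nr" by (simp add: F_def)
  have EF: "(E * F) $$ (i, k) = (if i = k \<and> f i < nc then 1 else 0)"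
    if ik: "i < nr" "k < nr" for i k
  proof -
    have "(E * F) $$ (i, k) = (\<Sum>j = 0..<nc. E $$ (i, j) * (if j = f k then 1 else 0))"
      using E ik by (simp add: F_def scalar_prod_def)
    also have "\<dots> = (\<Sum>j = 0..<nc. if f k = j then E $$ (i, j) else 0)"
      by (rule sum.cong) auto
    also have "\<dots> = (if f k < nc then E $$ (i, f k) else 0)"
      by (simp add: sum.delta')
    also have "\<dots> = (if i = k \<and> f i < nc then 1 else 0)"
      using pD(4)[OF ik(2)] pD(5)[OF ik(2) _ ik(1)] by auto
    finally show ?thesis .
  qed
  have EFE: "E * F * E = E"
  proof (rule eq_matI)
    fix i j assume "i < dim_row E" "j < dim_col E"
    then have i: "i < nr" and j: "j < nc" using E by auto
    have "(E * F * E) $$ (i, j) = (\<Sum>k = 0..<nr. (E * F) $$ (i, k) * E $$ (k, j))"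
      using E F i j by (simp add: scalar_prod_def del: assoc_mult_mat)
    also have "\<dots> = (\<Sum>k = 0..<nr. if i = k then (if f i < nc then E $$ (i, j) else 0) else 0)"
      using i by (intro sum.cong) (auto simp: EF)
    also have "\<dots> = (if f i < nc then E $$ (i, j) else 0)"
      using i by (simp add: sum.delta')
    also have "\<dots> = E $$ (i, j)"
      using pD(1)[OF i] pD(2)[OF i, of j] j by auto
    finally show "(E * F * E) $$ (i, j) = E $$ (i, j)" .
  qed (use E F in auto)
  have KQE: "K = Q * E"
    using assoc_mult_mat[OF Q P K] K QP by (simp add: EPK)
  have "K * (F * P) * K = K * F * (P * K)"
    using K F P by (simp add: assoc_mult_mat[of _ nr nc _ nr _ nr]
        assoc_mult_mat[of _ nr nr _ nr _ nc] assoc_mult_mat[of _ nc nr _ nr _ nc]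
        assoc_mult_mat[of _ nr nc _ nr _ nc])
  also have "\<dots> = Q * E * F * E" using KQE EPK by simp
  also have "\<dots> = Q * (E * F * E)"
    using Q E F by (simp add: assoc_mult_mat[of _ nr nr _ nc _ nr] assoc_mult_mat[of _ nr nr _ nr _ nc])
  finally have "K * (F * P) * K = K" using EFE KQE by simp
  then show ?thesis using F P by (intro bexI[of _ "F * P"]) auto
qed

text \<open>A column of the reduced echelon form without a pivot depends on the pivot columns before
  it, and this dependence is a nonzero kernel vector. Injectivity therefore forces a pivot in every
  column, which leaves an identity block above zero rows.\<close>

lemma injective_mat_normal_form:
  fixes B :: "'a :: field mat"
  assumes B: "B \<in> carrier_mat d m"
    and inj: "\<And>x. x \<in> carrier_vec m \<Longrightarrow> B *\<^sub>v x = 0\<^sub>v d \<Longrightarrow> x = 0\<^sub>v m"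
  shows "m \<le> d" and "\<exists>P Q. P \<in> carrier_mat d d \<and> Q \<in> carrier_mat d d \<and> P * Q = 1\<^sub>m d
    \<and> Q * P = 1\<^sub>m d \<and> P * B = mat d m (\<lambda>(i, j). if i = j then 1 else 0)"
proof -
  define E where "E = gauss_jordan_single B"
  note gj = gauss_jordan_single[OF B E_def[symmetric]]
  have E: "E \<in> carrier_mat d m" by (rule gj(2))
  obtain f where "pivot_fun E f (dim_col E)"
    using gj(3) unfolding row_echelon_form_def by blast
  then have piv: "pivot_fun E f m" using E by simp
  note pD = pivot_funD[OF carrier_matD(1)[OF E] piv]
  have f: "i < d \<and> f i = i" if "i < m" for i
    using that
  proof (induction i rule: less_induct)
    case (less i)
    have before: "r < d" "f r = r" if "r < i" for r
      using less.IH[OF that] less.prems that by auto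
    show ?case
    proof (rule ccontr)
      assume not_pivot: "\<not> (i < d \<and> f i = i)"
      \<comment> \<open>The columns before \<open>i\<close> hold the pivots of the first
        \<open>i\<close> rows. Pivots move strictly to the right, so if the next one misses column
        \<open>i\<close>, all later ones lie beyond it.\<close>
      have f_gt: "i < f r" if r: "i \<le> r" "r < d" for r
      proof -
        have ge: "i \<le> f i" if "i < d"
        proof (cases i)
          case (Suc k)
          then show ?thesis using pD(3)[of k] before[of k] that less.prems by auto
        qed simp
        have "f r = m \<or> f r \<ge> (r - i) + f i"
          using pivot_bound[OF carrier_matD(1)[OF E] piv, of i "r - i"] r by simp
        then show ?thesis using ge not_pivot r less.prems by fastforce
      qed
      \<comment> \<open>The columns \<open>j < i\<close> of \<open>E\<close> are unit vectors, so
        the entries of column \<open>i\<close> are its coefficients over them; \<open>x\<close>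
        records this relation.\<close>
      define x where "x = vec m (\<lambda>j. if j = i then - 1 else if j < i then E $$ (j, i) else 0)"
      have x: "x \<in> carrier_vec m" by (simp add: x_def)
      have "E *\<^sub>v x = 0\<^sub>v d"
      proof (rule eq_vecI)
        fix r assume "r < dim_vec (0\<^sub>v d :: 'a vec)"
        then have r: "r < d" by simp
        have E0: "E $$ (r, j) = (if j = r then 1 else 0)" if "j < i" for j
          using pD(4)[of j] pD(5)[of j r] before[OF that] that less.prems r by auto
        have "(E *\<^sub>v x) $ r = (\<Sum>j = 0..<m. E $$ (r, j) * x $ j)"
          using E r x by (simp add: scalar_prod_def)
        also have "\<dots> = (\<Sum>j = 0..<m. (if i = j then - E $$ (r, i) else 0)
            + (if r = j then if r < i then E $$ (r, i) else 0 else 0))"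
          by (rule sum.cong) (auto simp: x_def E0)
        also have "\<dots> = - E $$ (r, i) + (if r < i then E $$ (r, i) else 0)"
          using less.prems by (simp add: sum.distrib sum.delta')
        also have "\<dots> = 0"
          using f_gt[of r] pD(2)[of r i] r by auto
        finally show "(E *\<^sub>v x) $ r = 0\<^sub>v d $ r" using r by simp
      qed (use E in auto)
      then have "x = 0\<^sub>v m" using inj[OF x] gj(1)[OF x] by simp
      moreover have "x $ i = - 1" using less.prems by (simp add: x_def)
      ultimately show False using less.prems by simp
    qed
  qed
  show "m \<le> d" using f[of "m - 1"] by (cases m) auto
  have "E = mat d m (\<lambda>(i, j). if i = j then 1 else 0)"
    by (rule eq_matI) (use E f pD(4,5) in fastforce)+
  then show "\<exists>P Q. P \<in> carrier_mat d d \<and> Q \<in> carrier_mat d d \<and> P * Q = 1\<^sub>m d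
    \<and> Q * P = 1\<^sub>m d \<and> P * B = mat d m (\<lambda>(i, j). if i = j then 1 else 0)"
    using gj(4) by metis
qed

subsection \<open>Jordan form of a nilpotent matrix\<close>

lemma pow_mat_add:
  fixes A :: "'a :: semiring_1 mat"
  assumes "A \<in> carrier_mat n n"
  shows "A ^\<^sub>m (i + j) = A ^\<^sub>m i * A ^\<^sub>m j"
proof (induction j)
  case (Suc j)
  have "A ^\<^sub>m (i + Suc j) = A ^\<^sub>m i * A ^\<^sub>m j * A" using Suc by simp
  also have "\<dots> = A ^\<^sub>m i * A ^\<^sub>m Suc j"
    using assms by (simp add: assoc_mult_mat[of _ n n _ n _ n])
  finally show ?case .
qed (use assms in simp)

lemma pow_mat_Suc_left:
  fixes A :: "'a :: semiring_1 mat"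
  assumes "A \<in> carrier_mat n n"
  shows "A ^\<^sub>m Suc k = A * A ^\<^sub>m k"
  using pow_mat_add[OF assms, of 1 k] assms by simp

lemma transpose_pow_mat:
  fixes A :: "'a :: comm_semiring_1 mat"
  assumes A: "A \<in> carrier_mat n n"
  shows "(A ^\<^sub>m k)\<^sup>T = A\<^sup>T ^\<^sub>m k"
proof (induction k)
  case (Suc k)
  have "(A ^\<^sub>m Suc k)\<^sup>T = A\<^sup>T * A\<^sup>T ^\<^sub>m k"
    using A by (simp add: transpose_mult[of _ n n _ n] flip: Suc)
  then show ?case using pow_mat_Suc_left[of "A\<^sup>T"] A by simp
qed (use A in simp)

lemma jordan_block_0_mult_index:
  fixes A :: "'a :: comm_ring_1 mat"
  assumes "A \<in> carrier_mat m c" "i < m" "j < c"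
  shows "(jordan_block m 0 * A) $$ (i, j) = (if Suc i < m then A $$ (Suc i, j) else 0)"
proof -
  have "(jordan_block m 0 * A) $$ (i, j)
      = (\<Sum>k = 0..<m. (if i = k then 0 else if Suc i = k then 1 else 0) * A $$ (k, j))"
    using assms by (simp add: scalar_prod_def)
  also have "\<dots> = (\<Sum>k = 0..<m. if Suc i = k then A $$ (k, j) else 0)"
    by (rule sum.cong) auto
  finally show ?thesis by (simp add: sum.delta')
qed

lemma mult_jordan_block_0_index:
  fixes A :: "'a :: comm_ring_1 mat"
  assumes "A \<in> carrier_mat r m" "i < r" "j < m"
  shows "(A * jordan_block m 0) $$ (i, j) = (if j = 0 then 0 else A $$ (i, j - 1))"
proof -
  have "(A * jordan_block m 0) $$ (i, j)
      = (\<Sum>k = 0..<m. A $$ (i, k) * (if k = j then 0 else if Suc k = j then 1 else 0))"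
    using assms by (simp add: scalar_prod_def)
  also have "\<dots> = (\<Sum>k = 0..<m. if k = j - 1 then if j = 0 then 0 else A $$ (i, k) else 0)"
    by (rule sum.cong) auto
  finally show ?thesis using assms by (simp add: sum.delta)
qed

lemma det_nonzero_inverse:
  fixes G :: "'a :: field mat"
  assumes "G \<in> carrier_mat d d" "det G \<noteq> 0"
  obtains H where "H \<in> carrier_mat d d" "G * H = 1\<^sub>m d" "H * G = 1\<^sub>m d"
  using det_non_zero_imp_unit[OF assms, of undefined]
  by (auto simp: Units_def ring_mat_simps)

lemma det_upper_unitriangular:
  fixes A :: "'a :: idom mat"
  assumes "A \<in> carrier_mat n n" "upper_triangular A" "\<And>i. i < n \<Longrightarrow> A $$ (i, i) = 1"
  shows "det A = 1"
  unfolding det_upper_triangular[OF assms(2,1)]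
  using assms(1,3) by (intro prod_list_neutral) (auto simp: diag_mat_def)

text \<open>The vectors \<open>N^(m-1) p, ..., p\<close> span an invariant subspace (columns of
  \<open>B\<close>), and the functionals \<open>w N^i\<close> span an invariant space of functionals
  (rows of \<open>A\<close>). The pairing matrix \<open>A * B\<close> is upper unitriangular,
  because \<open>N^m = 0\<close> and \<open>w\<close> pairs to 1 with \<open>N^(m-1) p\<close>. So
  the common kernel of the functionals is an invariant complement of the subspace, and
  \<open>N'\<close> describes \<open>N\<close> on it.\<close>

lemma split_off_nilpotent_block:
  fixes N :: "'a :: field mat"
  assumes N: "N \<in> carrier_mat d d" and nil: "N ^\<^sub>m m = 0\<^sub>m d d" and m: "0 < m"
    and p: "p \<in> carrier_vec d" and w: "w \<in> carrier_vec d"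
    and wp: "w \<bullet> (N ^\<^sub>m (m - 1) *\<^sub>v p) = 1"
  obtains c N' P Q where "d = m + c" "N' \<in> carrier_mat c c"
    "similar_mat_wit N (four_block_mat (jordan_block m 0) (0\<^sub>m m c) (0\<^sub>m c m) N') P Q"
    "Q *\<^sub>v (N ^\<^sub>m (m - 1) *\<^sub>v p) = unit_vec d 0"
proof -
  let ?J = "jordan_block m (0 :: 'a)"
  have J: "?J \<in> carrier_mat m m" by simp
  define A where "A = mat m d (\<lambda>(i, j). (N\<^sup>T ^\<^sub>m i *\<^sub>v w) $ j)"
  \<comment> \<open>The powers descend with the column index, so that \<open>N\<close> moves each
    column to its left neighbour and kills column 0; this is right multiplication by the Jordan
    block.\<close>
  define B where "B = mat d m (\<lambda>(i, k). (N ^\<^sub>m (m - 1 - k) *\<^sub>v p) $ i)"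
  have A: "A \<in> carrier_mat m d" and B: "B \<in> carrier_mat d m"
    by (simp_all add: A_def B_def)
  have NT: "N\<^sup>T \<in> carrier_mat d d" using N by simp
  note powc = pow_carrier_mat[OF N] and powTc = pow_carrier_mat[OF NT]
  have rowA: "row A i = N\<^sup>T ^\<^sub>m i *\<^sub>v w" if "i < m" for i
    using that w powTc[of i] by (intro eq_vecI) (auto simp: A_def)
  have colB: "col B k = N ^\<^sub>m (m - 1 - k) *\<^sub>v p" if "k < m" for k
    using that p powc[of "m - 1 - k"] by (intro eq_vecI) (auto simp: B_def)
  have zero_pow: "N ^\<^sub>m k = 0\<^sub>m d d" if "m \<le> k" for k
    using pow_mat_add[OF N, of m "k - m"] that nil left_mult_zero_mat[OF powc[of "k - m"], of d] by simp
  have NB: "N * B = B * ?J"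
  proof (rule eq_matI)
    fix i k assume "i < dim_row (B * ?J)" "k < dim_col (B * ?J)"
    then have i: "i < d" and k: "k < m" using B by auto
    have "(N * B) $$ (i, k) = (N *\<^sub>v col B k) $ i" using N B i k by simp
    also have "N *\<^sub>v col B k = N ^\<^sub>m Suc (m - 1 - k) *\<^sub>v p"
      using powc p N k by (simp only: colB pow_mat_Suc_left[OF N] assoc_mult_mat_vec[OF N powc p])
    also have "\<dots> $ i = (B * ?J) $$ (i, k)"
    proof (cases k)
      case 0
      then show ?thesis
        unfolding mult_jordan_block_0_index[OF B i k]
        using m zero_pow[of m] i p by (simp del: pow_mat.simps)
    next
      case (Suc l)
      then have "Suc (m - 1 - k) = m - 1 - l" using k by simp
      then show ?thesis
        unfolding mult_jordan_block_0_index[OF B i k]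
        using Suc i k by (simp add: B_def del: pow_mat.simps)
    qed
    finally show "(N * B) $$ (i, k) = (B * ?J) $$ (i, k)" .
  qed (use N B in auto)
  have AN: "A * N = ?J * A"
  proof (rule eq_matI)
    fix i j assume "i < dim_row (?J * A)" "j < dim_col (?J * A)"
    then have i: "i < m" and j: "j < d" using A by auto
    have "(A * N) $$ (i, j) = row A i \<bullet> col N j" using A N i j by simp
    also have "\<dots> = (N\<^sup>T *\<^sub>v row A i) $ j"
      using A N i j by (simp add: comm_scalar_prod[of _ d])
    also have "N\<^sup>T *\<^sub>v row A i = N\<^sup>T ^\<^sub>m Suc i *\<^sub>v w"
      using i by (simp only: rowA pow_mat_Suc_left[OF NT] assoc_mult_mat_vec[OF NT powTc w])
    also have "\<dots> $ j = (?J * A) $$ (i, j)"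
    proof (cases "Suc i < m")
      case True
      then show ?thesis
        unfolding jordan_block_0_mult_index[OF A i j]
        using j by (simp add: A_def del: pow_mat.simps)
    next
      case False
      then have "Suc i = m" using i by simp
      then have "N\<^sup>T ^\<^sub>m Suc i = 0\<^sub>m d d"
        using nil N by (simp flip: transpose_pow_mat del: pow_mat.simps)
      then show ?thesis
        unfolding jordan_block_0_mult_index[OF A i j]
        using j w False by (simp del: pow_mat.simps)
    qed
    finally show "(A * N) $$ (i, j) = (?J * A) $$ (i, j)" .
  qed (use N A in auto)
  have AB: "A * B \<in> carrier_mat m m" using A B by simp
  have AB_index: "(A * B) $$ (i, k) = w \<bullet> (N ^\<^sub>m (i + (m - 1 - k)) *\<^sub>v p)"
    if i: "i < m" and k: "k < m" for i k
  proof -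
    have "(A * B) $$ (i, k) = row A i \<bullet> col B k" using A B i k by simp
    also have "\<dots> = w \<bullet> (N ^\<^sub>m i *\<^sub>v (N ^\<^sub>m (m - 1 - k) *\<^sub>v p))"
      using transpose_vec_mult_scalar[OF powc mult_mat_vec_carrier[OF powc p] w]
      by (simp add: rowA[OF i] colB[OF k] transpose_pow_mat[OF N])
    also have "\<dots> = w \<bullet> (N ^\<^sub>m (i + (m - 1 - k)) *\<^sub>v p)"
      by (simp only: pow_mat_add[OF N] assoc_mult_mat_vec[OF powc powc p])
    finally show ?thesis .
  qed
  have AB_lower: "(A * B) $$ (i, k) = 0" if "k < i" "i < m" for i k
  proof -
    have "N ^\<^sub>m (i + (m - 1 - k)) *\<^sub>v p = 0\<^sub>v d"
      using that zero_pow[of "i + (m - 1 - k)"] p by (intro eq_vecI) auto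
    then show ?thesis using that AB_index[of i k] w by simp
  qed
  have AB_diag: "(A * B) $$ (i, i) = 1" if "i < m" for i
    using that AB_index[of i i] wp by simp
  have "upper_triangular (A * B)" using AB_lower A by (intro upper_triangularI) auto
  then have detAB: "det (A * B) = 1" by (rule det_upper_unitriangular[OF AB _ AB_diag])
  have inj: "x = 0\<^sub>v m" if x: "x \<in> carrier_vec m" and "B *\<^sub>v x = 0\<^sub>v d" for x
  proof -
    have "A *\<^sub>v 0\<^sub>v d = 0\<^sub>v m" using A by (intro eq_vecI) auto
    then have "(A * B) *\<^sub>v x = 0\<^sub>v m" using that A B by simp
    then show ?thesis using det_0_iff_vec_prod_zero[OF AB] detAB x by auto
  qed
  define c where "c = d - m"
  have d: "d = m + c" using injective_mat_normal_form(1)[OF B inj] by (simp add: c_def)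
  let ?E = "mat d m (\<lambda>(i, j). if i = j then 1 else 0) :: 'a mat"
  obtain P P' where P: "P \<in> carrier_mat d d" and P': "P' \<in> carrier_mat d d"
    and PP': "P * P' = 1\<^sub>m d" and P'P: "P' * P = 1\<^sub>m d" and PB: "P * B = ?E"
    using injective_mat_normal_form(2)[OF B inj] by blast
  \<comment> \<open>In the new coordinates the columns of \<open>B\<close> are the first
    \<open>m\<close> unit vectors; \<open>M\<close> is the operator and \<open>C\<close> collects
    the functionals.\<close>
  define M where "M = P * N * P'"
  have M: "M \<in> carrier_mat d d" using P N P' by (simp add: M_def)
  define C where "C = A * P'"
  have C: "C \<in> carrier_mat m d" using A P' by (simp add: C_def)
  have MP: "M * P = P * N"
    using P P' N P'P by (simp add: M_def assoc_mult_mat[of _ d d _ d _ d])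
  have ME: "M * ?E = ?E * ?J"
  proof -
    have "M * (P * B) = (P * N) * B" using MP assoc_mult_mat[OF M P B] by simp
    also have "\<dots> = (P * B) * ?J"
      using NB assoc_mult_mat[OF P N B] assoc_mult_mat[OF P B J] by simp
    finally show ?thesis by (simp add: PB)
  qed
  have CM: "C * M = ?J * C"
  proof -
    have "C * M = A * ((P' * P) * (N * P'))"
      using A P P' N by (simp add: C_def M_def assoc_mult_mat[of _ d d _ d _ d]
          assoc_mult_mat[of _ m d _ d _ d])
    also have "\<dots> = (A * N) * P'" using A P' N by (simp add: P'P assoc_mult_mat[of _ m d _ d _ d])
    also have "\<dots> = ?J * C" using AN A P' by (simp add: C_def assoc_mult_mat[OF J])
    finally show ?thesis .
  qed
  have CE: "C * ?E = A * B"
  proof -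
    have "P' * (P * B) = B" using assoc_mult_mat[OF P' P B] P'P B by simp
    then have "C * (P * B) = A * B"
      using assoc_mult_mat[OF A P' mult_carrier_mat[OF P B]] by (simp add: C_def)
    then show ?thesis by (simp add: PB)
  qed
  have mult_E: "(X * ?E) $$ (i, k) = X $$ (i, k)" if "X \<in> carrier_mat r d" "i < r" "k < m" for X r i k
  proof -
    have "(X * ?E) $$ (i, k) = (\<Sum>j = 0..<d. X $$ (i, j) * (if j = k then 1 else 0))"
      using that by (simp add: scalar_prod_def)
    also have "\<dots> = (\<Sum>j = 0..<d. if j = k then X $$ (i, j) else 0)"
      by (rule sum.cong) auto
    finally show ?thesis using that d by (simp add: sum.delta)
  qed
  have C_index: "C $$ (i, k) = (A * B) $$ (i, k)" if "i < m" "k < m" for i k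
    using mult_E[OF C that] CE by simp
  have M_index: "M $$ (i, k) = (if Suc i = k then 1 else 0)" if "i < d" "k < m" for i k
  proof -
    have "M $$ (i, k) = (?E * ?J) $$ (i, k)" using mult_E[OF M that] ME by simp
    also have "\<dots> = (if k = 0 then 0 else ?E $$ (i, k - 1))"
      using that by (intro mult_jordan_block_0_index) auto
    finally show ?thesis using that by auto
  qed
  \<comment> \<open>The first \<open>m\<close> columns of \<open>M\<close> vanish below row
    \<open>m\<close>, so this lower right block is the action on the quotient by the span of the
    columns of \<open>B\<close>.\<close>
  define N' where "N' = mat c c (\<lambda>(i, j). M $$ (i + m, j + m))"
  have N': "N' \<in> carrier_mat c c" by (simp add: N'_def)
  let ?D = "four_block_mat ?J (0\<^sub>m m c) (0\<^sub>m c m) N'"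
  have D: "?D \<in> carrier_mat d d" using N' d by simp
  \<comment> \<open>A second coordinate change: the first \<open>m\<close> coordinates become the
    values of the functionals, the others stay. Since \<open>C * M = ?J * C\<close>, the upper right
    block disappears. The leading block of \<open>C\<close> is \<open>A * B\<close>, so
    \<open>G\<close> is upper unitriangular.\<close>
  define G where "G = mat d d (\<lambda>(i, j). if i < m then C $$ (i, j) else if i = j then 1 else 0)"
  have G: "G \<in> carrier_mat d d" by (simp add: G_def)
  have mult_index: "(X * Y) $$ (i, j) = (\<Sum>k = 0..<d. X $$ (i, k) * Y $$ (k, j))"
    if "X \<in> carrier_mat d d" "Y \<in> carrier_mat d d" "i < d" "j < d" for X Y :: "'a mat" and i j
    using that by (simp add: scalar_prod_def)
  have GM: "G * M = ?D * G"
  proof (rule eq_matI)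
    fix i j assume "i < dim_row (?D * G)" "j < dim_col (?D * G)"
    then have i: "i < d" and j: "j < d" using D G by auto
    show "(G * M) $$ (i, j) = (?D * G) $$ (i, j)"
    proof (cases "i < m")
      case True
      have "row G i = row C i" using True C i by (intro eq_vecI) (auto simp: G_def)
      then have "(G * M) $$ (i, j) = (C * M) $$ (i, j)" using True G C M i j by simp
      also have "\<dots> = (if Suc i < m then C $$ (Suc i, j) else 0)"
        unfolding CM by (rule jordan_block_0_mult_index[OF C True j])
      also have "\<dots> = (\<Sum>k = 0..<d. if k = Suc i then if Suc i < m then G $$ (k, j) else 0 else 0)"
        using True i j d by (auto simp: G_def sum.delta)
      also have "\<dots> = (\<Sum>k = 0..<d. ?D $$ (i, k) * G $$ (k, j))"
        using True i d N' by (intro sum.cong) auto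
      also have "\<dots> = (?D * G) $$ (i, j)" using mult_index[OF D G i j] by simp
      finally show ?thesis .
    next
      case False
      have "row G i = unit_vec d i" using False i by (intro eq_vecI) (auto simp: G_def)
      then have "(G * M) $$ (i, j) = M $$ (i, j)" using G M i j by simp
      also have "\<dots> = (\<Sum>k = 0..<d. if k = j then if j < m then 0 else M $$ (i, k) else 0)"
        using False i j by (auto simp: M_index sum.delta)
      also have "\<dots> = (\<Sum>k = 0..<d. ?D $$ (i, k) * G $$ (k, j))"
        using False i j d N' by (intro sum.cong) (auto simp: G_def N'_def)
      also have "\<dots> = (?D * G) $$ (i, j)" using mult_index[OF D G i j] by simp
      finally show ?thesis .
    qed
  qed (use G M D in auto)
  have "upper_triangular G"
    using C_index AB_lower by (intro upper_triangularI) (auto simp: G_def)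
  then have "det G = 1"
    by (rule det_upper_unitriangular[OF G]) (auto simp: G_def C_index AB_diag)
  then obtain H where H: "H \<in> carrier_mat d d" and GH: "G * H = 1\<^sub>m d" and HG: "H * G = 1\<^sub>m d"
    using det_nonzero_inverse[OF G] by auto
  have wit1: "similar_mat_wit N M P' P"
  proof (rule similar_mat_witI[OF P'P PP' _ N M P' P])
    have "P' * M * P = (P' * P) * N"
      using MP P P' M N by (simp add: assoc_mult_mat[of _ d d _ d _ d])
    then show "N = P' * M * P" using P'P N by simp
  qed
  have wit2: "similar_mat_wit M ?D H G"
  proof (rule similar_mat_witI[OF HG GH _ M D H G])
    have "H * ?D * G = (H * G) * M"
      using GM H D G M by (simp add: assoc_mult_mat[of _ d d _ d _ d])
    then show "M = H * ?D * G" using HG M by simp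
  qed
  \<comment> \<open>The prescribed vector is column 0 of \<open>B\<close>: \<open>P\<close> takes it
    to the zeroth unit vector, which the unitriangular \<open>G\<close> fixes.\<close>
  have "G * P *\<^sub>v (N ^\<^sub>m (m - 1) *\<^sub>v p) = G *\<^sub>v (P *\<^sub>v col B 0)"
    using colB[OF m] G P powc[of "m - 1"] p by (simp add: assoc_mult_mat_vec[of _ d d _ d])
  also have "P *\<^sub>v col B 0 = col (P * B) 0"
    using P B m by (intro eq_vecI) auto
  also have "\<dots> = unit_vec d 0"
    using m d by (intro eq_vecI) (auto simp: PB)
  also have "G *\<^sub>v unit_vec d 0 = unit_vec d 0"
    using m d AB_lower AB_diag by (intro eq_vecI) (auto simp: G_def C_index)
  finally show ?thesis
    using that[OF d N' similar_mat_wit_trans[OF wit1 wit2]] by simp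
qed

text \<open>With \<open>l\<close> the least exponent, \<open>N^(l-1)\<close> has a nonzero entry;
  unit vectors at its column and row, the latter rescaled, give \<open>p\<close> and
  \<open>w\<close>. Positivity of \<open>d\<close> excludes \<open>l = 0\<close>.\<close>

lemma nilpotency_index_exists:
  fixes N :: "'a :: field mat"
  assumes N: "N \<in> carrier_mat d d" and nil: "N ^\<^sub>m m = 0\<^sub>m d d" and d: "0 < d"
  obtains l p w where "0 < l" "l \<le> m" "N ^\<^sub>m l = 0\<^sub>m d d"
    "p \<in> carrier_vec d" "w \<in> carrier_vec d" "w \<bullet> (N ^\<^sub>m (l - 1) *\<^sub>v p) = 1"
proof -
  define l where "l = (LEAST l. N ^\<^sub>m l = 0\<^sub>m d d)"
  have l: "N ^\<^sub>m l = 0\<^sub>m d d" unfolding l_def using nil by (rule LeastI)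
  have lm: "l \<le> m" unfolding l_def using nil by (rule Least_le)
  have "(1\<^sub>m d :: 'a mat) $$ (0, 0) \<noteq> 0\<^sub>m d d $$ (0, 0)" using d by simp
  then have "N ^\<^sub>m 0 \<noteq> 0\<^sub>m d d" using N by auto
  then have l0: "0 < l" using l by (cases l) auto
  let ?K = "N ^\<^sub>m (l - 1)"
  have K: "?K \<in> carrier_mat d d" using N by simp
  have "?K \<noteq> 0\<^sub>m d d"
    using not_less_Least[of "l - 1" "\<lambda>l. N ^\<^sub>m l = 0\<^sub>m d d"] l0 by (simp flip: l_def)
  then obtain i j where ij: "i < d" "j < d" "?K $$ (i, j) \<noteq> 0"
    using K by (metis eq_matI carrier_matD index_zero_mat)
  show ?thesis
  proof (rule that[OF l0 lm l])
    have x: "?K *\<^sub>v unit_vec d j \<in> carrier_vec d" using K by simp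
    have "unit_vec d i \<bullet> (?K *\<^sub>v unit_vec d j) = ?K $$ (i, j)"
      using scalar_prod_left_unit[OF x ij(1)] ij N by simp
    then show "(inverse (?K $$ (i, j)) \<cdot>\<^sub>v unit_vec d i) \<bullet> (?K *\<^sub>v unit_vec d j) = 1"
      using smult_scalar_prod_distrib[OF unit_vec_carrier x] ij(3) by simp
  qed auto
qed

text \<open>The hypotheses on \<open>w\<close> and \<open>p\<close> make \<open>m\<close> the exact
  nilpotency index, so a block of maximal size is split off first. Only this block needs a
  prescribed first vector; on the complement fresh \<open>p\<close> and \<open>w\<close> are chosen.
  The bound \<open>k \<le> m\<close> is carried along to keep the sizes sorted.\<close>

lemma nilpotent_jordan_form:
  fixes N :: "'a :: field mat"
  assumes "N \<in> carrier_mat d d" and "N ^\<^sub>m m = 0\<^sub>m d d" and "0 < m"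
    and "p \<in> carrier_vec d" and "w \<in> carrier_vec d" and "w \<bullet> (N ^\<^sub>m (m - 1) *\<^sub>v p) = 1"
  shows "\<exists>ns P Q. sorted_wrt (\<ge>) ns \<and> (\<forall>k \<in> set ns. 0 < k \<and> k \<le> m) \<and> sum_list ns = d
    \<and> similar_mat_wit N (jordan_matrix (map (\<lambda>k. (k, 0)) ns)) P Q
    \<and> Q *\<^sub>v (N ^\<^sub>m (m - 1) *\<^sub>v p) = unit_vec d 0"
  using assms
proof (induction d arbitrary: N m p w rule: less_induct)
  case (less d N m p w)
  note N = less.prems(1) and m = less.prems(3)
  let ?v = "N ^\<^sub>m (m - 1) *\<^sub>v p"
  obtain c N' P Q where d: "d = m + c" and N': "N' \<in> carrier_mat c c"
    and wit: "similar_mat_wit N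
      (four_block_mat (jordan_block m 0) (0\<^sub>m m c) (0\<^sub>m c m) N') P Q"
    and Q: "Q *\<^sub>v ?v = unit_vec d 0"
    using split_off_nilpotent_block[OF less.prems] .
  let ?D = "four_block_mat (jordan_block m 0) (0\<^sub>m m c) (0\<^sub>m c m) N'"
  note w = similar_mat_witD2[OF N wit]
  \<comment> \<open>Nilpotency passes through the similarity to \<open>?D\<close>, and then to its
    lower right block.\<close>
  have "?D ^\<^sub>m m = Q * N ^\<^sub>m m * P"
    by (rule similar_mat_wit_pow_id[OF similar_mat_wit_sym[OF wit]])
  also have "\<dots> = 0\<^sub>m d d" using less.prems(2) w by simp
  finally have D0: "four_block_mat (jordan_block m 0 ^\<^sub>m m) (0\<^sub>m m c) (0\<^sub>m c m) (N' ^\<^sub>m m) = 0\<^sub>m d d"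
    using pow_four_block_mat[OF jordan_block_carrier N'] by simp
  have nil: "N' ^\<^sub>m m = 0\<^sub>m c c"
  proof (rule eq_matI)
    fix i j assume "i < dim_row (0\<^sub>m c c :: 'a mat)" "j < dim_col (0\<^sub>m c c :: 'a mat)"
    then show "(N' ^\<^sub>m m) $$ (i, j) = 0\<^sub>m c c $$ (i, j)"
      using arg_cong[OF D0, of "\<lambda>X. X $$ (i + m, j + m)"] N' d m
      by (simp add: pow_mat_dim_square[OF jordan_block_carrier])
  qed (use N' in auto)
  obtain ns P' Q' where ns: "sorted_wrt (\<ge>) ns" "\<forall>k \<in> set ns. 0 < k \<and> k \<le> m" "sum_list ns = c"
    and wit': "similar_mat_wit N' (jordan_matrix (map (\<lambda>k. (k, 0)) ns)) P' Q'"
  proof (cases "c = 0")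
    case True
    then have "N' = jordan_matrix (map (\<lambda>k. (k, 0)) [])"
      using N' by (intro eq_matI) auto
    then show ?thesis using that[of "[]"] True similar_mat_wit_refl[OF N'] by auto
  next
    case False
    \<comment> \<open>The complement may have a smaller nilpotency index \<open>l\<close>; the
      induction hypothesis is applied with \<open>l\<close> instead of \<open>m\<close>.\<close>
    obtain l p' w' where l: "0 < l" "l \<le> m" "N' ^\<^sub>m l = 0\<^sub>m c c"
      and pw: "p' \<in> carrier_vec c" "w' \<in> carrier_vec c" "w' \<bullet> (N' ^\<^sub>m (l - 1) *\<^sub>v p') = 1"
      using nilpotency_index_exists[OF N' nil] False by auto
    have "c < d" using d m by simp
    from less.IH[OF this N' l(3,1) pw] obtain ns P' Q' where
      "sorted_wrt (\<ge>) ns" and le: "\<forall>k \<in> set ns. 0 < k \<and> k \<le> l" and "sum_list ns = c"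
      "similar_mat_wit N' (jordan_matrix (map (\<lambda>k. (k, 0)) ns)) P' Q'"
      by blast
    moreover have "\<forall>k \<in> set ns. 0 < k \<and> k \<le> m" using le l(2) by auto
    ultimately show ?thesis using that by blast
  qed
  let ?ns = "m # ns"
  have len: "sum_list (map fst (map (\<lambda>k. (k, 0 :: 'a)) ns)) = c"
    using ns(3) by (simp add: comp_def)
  have J: "jordan_matrix (map (\<lambda>k. (k, 0 :: 'a)) ?ns) = four_block_mat (jordan_block m 0)
      (0\<^sub>m m c) (0\<^sub>m c m) (jordan_matrix (map (\<lambda>k. (k, 0)) ns))"
    using jordan_matrix_Cons[of m "0 :: 'a" "map (\<lambda>k. (k, 0)) ns"] len by simp
  note w' = similar_mat_witD2[OF N' wit']
  let ?R = "\<lambda>X. four_block_mat (1\<^sub>m m) (0\<^sub>m m c) (0\<^sub>m c m) X"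
  have wit2: "similar_mat_wit ?D (jordan_matrix (map (\<lambda>k. (k, 0)) ?ns)) (?R P') (?R Q')"
    unfolding J
    by (rule similar_mat_wit_four_block[OF similar_mat_wit_refl[OF jordan_block_carrier] wit' _ _
          jordan_block_carrier N'])
       (use w' in auto)
  have R: "?R Q' \<in> carrier_mat d d" using w' d by simp
  have v: "?v \<in> carrier_vec d"
    by (rule mult_mat_vec_carrier[OF pow_carrier_mat[OF N] less.prems(4)])
  \<comment> \<open>The base change of the complement is the identity on the first block, which
    contains coordinate 0 because \<open>m\<close> is positive.\<close>
  have "?R Q' * Q *\<^sub>v ?v = ?R Q' *\<^sub>v unit_vec d 0"
    using assoc_mult_mat_vec[OF R w(7) v] Q by simp
  also have "\<dots> = unit_vec d 0"
  proof (rule eq_vecI)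
    fix i assume "i < dim_vec (unit_vec d 0 :: 'a vec)"
    then have i: "i < d" by simp
    have "(?R Q' *\<^sub>v unit_vec d 0) $ i = ?R Q' $$ (i, 0)"
      using i R m d by (simp add: scalar_prod_right_unit del: index_mat_four_block)
    then show "(?R Q' *\<^sub>v unit_vec d 0) $ i = unit_vec d 0 $ i"
      using i m d w' by auto
  qed (use R in auto)
  finally have "?R Q' * Q *\<^sub>v ?v = unit_vec d 0" .
  moreover have "similar_mat_wit N (jordan_matrix (map (\<lambda>k. (k, 0)) ?ns)) (P * ?R P') (?R Q' * Q)"
    by (rule similar_mat_wit_trans[OF wit wit2])
  ultimately show ?case
    using ns m d by (intro exI[of _ ?ns] exI conjI) auto
qed

subsection \<open>Nilpotency from a transitive commutant\<close>

lemma commute_pow_mat: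
  fixes A :: "'a :: semiring_1 mat"
  assumes A: "A \<in> carrier_mat n n" and S: "S \<in> carrier_mat n n" and "A * S = S * A"
  shows "A ^\<^sub>m k * S = S * A ^\<^sub>m k"
proof (induction k)
  case (Suc k)
  have P: "A ^\<^sub>m k \<in> carrier_mat n n" using A by simp
  have "A ^\<^sub>m Suc k * S = A ^\<^sub>m k * (S * A)"
    using assoc_mult_mat[OF P A S] assms(3) by simp
  also have "\<dots> = S * A ^\<^sub>m Suc k"
    using assoc_mult_mat[OF P S A] assoc_mult_mat[OF S P A] Suc by simp
  finally show ?case .
qed (use A S in simp)

lemma mult_mat_vec_unit:
  fixes A :: "'a :: semiring_1 mat"
  assumes "A \<in> carrier_mat nr nc" "j < nc"
  shows "A *\<^sub>v unit_vec nc j = col A j"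
  using assms by (intro eq_vecI) auto

lemma mult_mat_vec_zero:
  fixes A :: "'a :: semiring_1 mat"
  assumes "A \<in> carrier_mat nr nc"
  shows "A *\<^sub>v 0\<^sub>v nc = 0\<^sub>v nr"
  using assms by (intro eq_vecI) auto

text \<open>The setting is transposed, with columns in place of rows: \<open>M\<close> will be the
  transpose of \<open>z - 1\<close> and \<open>S\<close> the set of transposes of elements of
  \<open>R\<close>. Affine points are the vectors with zeroth entry 1, and
  \<open>unit_vec d 0\<close> is the origin among them.\<close>

context
  fixes M :: "'a :: field mat" and S :: "'a mat set" and d :: nat
  assumes d: "0 < d" and M: "M \<in> carrier_mat d d"
    and S: "\<And>s. s \<in> S \<Longrightarrow> s \<in> carrier_mat d d"
    and S_inv: "\<And>s. s \<in> S \<Longrightarrow> \<exists>t \<in> carrier_mat d d. t * s = 1\<^sub>m d"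
    and S_commute: "\<And>s. s \<in> S \<Longrightarrow> M * s = s * M"
    and S_transitive: "\<And>x. x \<in> carrier_vec d \<Longrightarrow> x $ 0 = 1 \<Longrightarrow> \<exists>s \<in> S. s *\<^sub>v unit_vec d 0 = x"
begin

text \<open>After rescaling, \<open>x\<close> is an affine point \<open>s e\<close>. As
  \<open>M^k\<close> commutes with the invertible \<open>s\<close>, it kills \<open>e\<close>, hence
  the whole orbit of \<open>e\<close>, and the affine points span the space.\<close>

lemma pow_eq_zero_if_kills_vec:
  assumes x: "x \<in> carrier_vec d" and x0: "x $ 0 \<noteq> 0" and kills: "M ^\<^sub>m k *\<^sub>v x = 0\<^sub>v d"
  shows "M ^\<^sub>m k = 0\<^sub>m d d"
proof -
  let ?e = "unit_vec d 0 :: 'a vec" and ?K = "M ^\<^sub>m k"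
  have K: "?K \<in> carrier_mat d d" using M by simp
  have e: "?e \<in> carrier_vec d" by simp
  have Ks: "?K *\<^sub>v (s *\<^sub>v ?e) = s *\<^sub>v (?K *\<^sub>v ?e)" if s: "s \<in> S" for s
    using commute_pow_mat[OF M S[OF s] S_commute[OF s], of k]
      assoc_mult_mat_vec[OF K S[OF s] e] assoc_mult_mat_vec[OF S[OF s] K e] by simp
  obtain s where s: "s \<in> S" "s *\<^sub>v ?e = inverse (x $ 0) \<cdot>\<^sub>v x"
    using S_transitive[of "inverse (x $ 0) \<cdot>\<^sub>v x"] x x0 d by auto
  obtain t where t: "t \<in> carrier_mat d d" "t * s = 1\<^sub>m d" using S_inv[OF s(1)] by blast
  have "s *\<^sub>v (?K *\<^sub>v ?e) = inverse (x $ 0) \<cdot>\<^sub>v (?K *\<^sub>v x)"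
    using Ks[OF s(1)] s(2) mult_mat_vec[OF K x] by simp
  moreover have "inverse (x $ 0) \<cdot>\<^sub>v 0\<^sub>v d = 0\<^sub>v d" by (intro eq_vecI) auto
  ultimately have "s *\<^sub>v (?K *\<^sub>v ?e) = 0\<^sub>v d" using kills by simp
  then have "t *\<^sub>v (s *\<^sub>v (?K *\<^sub>v ?e)) = 0\<^sub>v d" using mult_mat_vec_zero[OF t(1)] by simp
  then have Ke: "?K *\<^sub>v ?e = 0\<^sub>v d"
    using assoc_mult_mat_vec[OF t(1) S[OF s(1)] mult_mat_vec_carrier[OF K e]]
      t(2) mult_mat_vec_carrier[OF K e] by simp
  have Ky: "?K *\<^sub>v y = 0\<^sub>v d" if y: "y \<in> carrier_vec d" "y $ 0 = 1" for y
  proof -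
    obtain r where r: "r \<in> S" "r *\<^sub>v ?e = y" using S_transitive[OF y] by blast
    then show ?thesis using Ks[OF r(1)] Ke mult_mat_vec_zero[OF S[OF r(1)]] by simp
  qed
  \<comment> \<open>For \<open>j\<close> other than 0, the unit vector is the difference of the
    affine points \<open>e + unit_vec d j\<close> and \<open>e\<close>.\<close>
  have col: "?K *\<^sub>v unit_vec d j = 0\<^sub>v d" if "j < d" for j
  proof (cases "j = 0")
    case False
    have "?K *\<^sub>v (?e + unit_vec d j) = ?K *\<^sub>v ?e + ?K *\<^sub>v unit_vec d j"
      using K by (intro mult_add_distrib_mat_vec) auto
    moreover have "?K *\<^sub>v (?e + unit_vec d j) = 0\<^sub>v d"
      using False d that by (intro Ky) auto
    ultimately show ?thesis using Ke K mult_mat_vec_carrier[OF K, of "unit_vec d j"] by simp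
  qed (use Ke in simp)
  show ?thesis
  proof (rule eq_matI)
    fix i j assume "i < dim_row (0\<^sub>m d d :: 'a mat)" "j < dim_col (0\<^sub>m d d :: 'a mat)"
    then have ij: "i < d" "j < d" by auto
    have "?K $$ (i, j) = col ?K j $ i" using ij M by simp
    then show "?K $$ (i, j) = 0\<^sub>m d d $$ (i, j)"
      using col[OF ij(2)] ij by (simp add: mult_mat_vec_unit[OF K])
  qed (use K in auto)
qed

text \<open>A linear relation \<open>\<Sum>j. a\<^sub>j M\<^sup>j e = 0\<close> with first nonzero coefficient \<open>a\<^sub>k\<close>
  shows that \<open>M\<^sup>k\<close> kills a vector whose first entry is \<open>a\<^sub>k\<close>.\<close>

lemma nilpotent_if_transitive_commutant:
  assumes row0: "row M 0 = 0\<^sub>v d"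
  shows "\<exists>k. M ^\<^sub>m k = 0\<^sub>m d d"
proof -
  let ?e = "unit_vec d 0 :: 'a vec"
  have e: "?e \<in> carrier_vec d" by simp
  have pw: "M ^\<^sub>m k \<in> carrier_mat d d" for k using M by simp
  have pwe: "M ^\<^sub>m k *\<^sub>v ?e \<in> carrier_vec d" for k by (rule mult_mat_vec_carrier[OF pw e])
  \<comment> \<open>The columns are the \<open>d + 1\<close> iterates of \<open>e\<close>; an added
    zero row makes the matrix square and singular, so a linear relation \<open>a\<close> among them
    exists.\<close>
  define W where "W = mat (Suc d) (Suc d) (\<lambda>(i, j). if i < d then (M ^\<^sub>m j *\<^sub>v ?e) $ i else 0)"
  have W: "W \<in> carrier_mat (Suc d) (Suc d)" by (simp add: W_def)
  have "W\<^sup>T *\<^sub>v unit_vec (Suc d) d = 0\<^sub>v (Suc d)"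
    using W by (subst mult_mat_vec_unit[of _ "Suc d"]) (auto simp: W_def)
  moreover have "(unit_vec (Suc d) d :: 'a vec) \<noteq> 0\<^sub>v (Suc d)" by simp
  ultimately have "det (W\<^sup>T) = 0"
    using det_0_iff_vec_prod_zero[of "W\<^sup>T" "Suc d"] W unit_vec_carrier[of "Suc d" d]
    by (metis transpose_carrier_mat)
  then obtain a where a: "a \<in> carrier_vec (Suc d)" "a \<noteq> 0\<^sub>v (Suc d)" and Wa: "W *\<^sub>v a = 0\<^sub>v (Suc d)"
    using det_0_iff_vec_prod_zero[OF W] det_transpose[OF W] by auto
  define k where "k = (LEAST k. k \<le> d \<and> a $ k \<noteq> 0)"
  have "\<exists>k. k \<le> d \<and> a $ k \<noteq> 0"
  proof (rule ccontr)
    assume "\<not> ?thesis"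
    then have "a = 0\<^sub>v (Suc d)" using a(1) by (intro eq_vecI) auto
    then show False using a(2) by simp
  qed
  then have "k \<le> d \<and> a $ k \<noteq> 0" unfolding k_def by (rule LeastI_ex)
  then have k: "k \<le> d" "a $ k \<noteq> 0" by auto
  have before: "a $ j = 0" if "j < k" for j
    using not_less_Least[of j "\<lambda>k. k \<le> d \<and> a $ k \<noteq> 0"] that k(1) by (auto simp: k_def)
  \<comment> \<open>Dividing the relation by \<open>M^k\<close>: the columns from \<open>k\<close>
    on are the iterates starting again at \<open>e\<close>, so \<open>M^k\<close> sends
    \<open>X a\<close> to \<open>W a = 0\<close>. The columns before \<open>k\<close> meet zero
    coefficients.\<close>
  define X where "X = mat d (Suc d) (\<lambda>(i, j). if j < k then 0 else (M ^\<^sub>m (j - k) *\<^sub>v ?e) $ i)"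
  have X: "X \<in> carrier_mat d (Suc d)" by (simp add: X_def)
  \<comment> \<open>Row 0 of \<open>M\<close> is zero, so among the iterates only \<open>e\<close>
    itself has a nonzero zeroth entry.\<close>
  have pow0: "(M ^\<^sub>m l *\<^sub>v ?e) $ 0 = (if l = 0 then 1 else 0)" for l
  proof (cases l)
    case 0
    then show ?thesis using M d by simp
  next
    case (Suc r)
    have "(M *\<^sub>v (M ^\<^sub>m r *\<^sub>v ?e)) $ 0 = 0" using row0 M d pwe[of r] by simp
    then show ?thesis
      using Suc by (simp only: pow_mat_Suc_left[OF M] assoc_mult_mat_vec[OF M pw e]) simp
  qed
  have "(X *\<^sub>v a) $ 0 = (\<Sum>j = 0..<Suc d. X $$ (0, j) * a $ j)"
    using X a(1) d by (simp add: scalar_prod_def)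
  also have "\<dots> = (\<Sum>j = 0..<Suc d. if j = k then a $ j else 0)"
    using d by (intro sum.cong) (auto simp: X_def pow0 simp del: pow_mat.simps)
  also have "\<dots> = a $ k" using k(1) by (subst sum.delta) auto
  finally have first: "(X *\<^sub>v a) $ 0 = a $ k" .
  have "M ^\<^sub>m k *\<^sub>v (X *\<^sub>v a) = 0\<^sub>v d"
  proof (rule eq_vecI)
    fix i assume "i < dim_vec (0\<^sub>v d :: 'a vec)"
    then have i: "i < d" by simp
    have entry: "(M ^\<^sub>m k * X) $$ (i, j) * a $ j = W $$ (i, j) * a $ j" if j: "j < Suc d" for j
    proof (cases "j < k")
      case False
      have "col X j = M ^\<^sub>m (j - k) *\<^sub>v ?e"
        using False j M by (intro eq_vecI) (auto simp: X_def)
      then have "(M ^\<^sub>m k * X) $$ (i, j) = (M ^\<^sub>m k *\<^sub>v (M ^\<^sub>m (j - k) *\<^sub>v ?e)) $ i"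
        using i j X M by simp
      also have "\<dots> = (M ^\<^sub>m j *\<^sub>v ?e) $ i"
        using pow_mat_add[OF M, of k "j - k"] False
        by (simp flip: assoc_mult_mat_vec[OF pw pw e])
      finally show ?thesis using i j by (simp add: W_def)
    qed (use before in simp)
    have "M ^\<^sub>m k *\<^sub>v (X *\<^sub>v a) = (M ^\<^sub>m k * X) *\<^sub>v a"
      using assoc_mult_mat_vec[OF pw X a(1)] by simp
    also have "\<dots> $ i = (\<Sum>j = 0..<Suc d. (M ^\<^sub>m k * X) $$ (i, j) * a $ j)"
      using i X a(1) M by (simp add: scalar_prod_def del: sum.op_ivl_Suc index_mult_mat(1))
    also have "\<dots> = (\<Sum>j = 0..<Suc d. W $$ (i, j) * a $ j)"
      using entry by (intro sum.cong) auto
    also have "\<dots> = (W *\<^sub>v a) $ i"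
      using i W a(1) by (simp add: scalar_prod_def)
    finally show "(M ^\<^sub>m k *\<^sub>v (X *\<^sub>v a)) $ i = 0\<^sub>v d $ i" using Wa i by simp
  qed (use carrier_matD[OF pw] in simp)
  then show ?thesis
    using pow_eq_zero_if_kills_vec[of "X *\<^sub>v a" k] X a(1) first k(2) by auto
qed

end

subsection \<open>Central elements of regular subgroups\<close>

text \<open>This transfers the Jordan form of the nilpotent \<open>z - 1\<close> to \<open>z\<close>
  with the same base change.\<close>

lemma jordan_matrix_1_eq:
  "jordan_matrix (map (\<lambda>k. (k, 1)) ns)
    = 1\<^sub>m (sum_list ns) + jordan_matrix (map (\<lambda>k. (k, 0 :: 'a :: field)) ns)"
proof (induction ns)
  case Nil
  show ?case by (intro eq_matI) auto
next
  case (Cons k ns)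
  have len: "sum_list (map fst (map (\<lambda>k. (k, c :: 'a)) ns)) = sum_list ns" for c
    by (simp add: comp_def)
  have J: "jordan_matrix (map (\<lambda>k. (k, c :: 'a)) ns) \<in> carrier_mat (sum_list ns) (sum_list ns)" for c
    using jordan_matrix_carrier[of "map (\<lambda>k. (k, c)) ns"] unfolding len .
  show ?case
    unfolding list.map jordan_matrix_Cons len Cons.IH
    by (intro eq_matI) (use J[of 0] in auto)
qed

theorem theorem4p4:
  fixes n :: nat and R :: "'a :: field mat set" and z :: "'a mat"
  assumes "regular_subgroup n R"
    and "z \<in> center (AGL n\<lparr>carrier := R\<rparr>)"
    and "z \<noteq> \<one>\<^bsub>AGL n\<^esub>"
  shows "\<exists>ns. unipotent_jordan_form z ns \<and>
           (\<exists>g \<in> carrier (AGL n).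
              inv\<^bsub>AGL n\<^esub> g \<otimes>\<^bsub>AGL n\<^esub> z \<otimes>\<^bsub>AGL n\<^esub> g = unipotent_jordan_matrix ns)"
proof -
  define d where "d = Suc n"
  have d: "0 < d" by (simp add: d_def)
  let ?e = "unit_vec d 0 :: 'a vec"
  interpret group "AGL n :: 'a mat monoid" by (rule group_AGL)
  have sub: "subgroup R (AGL n)"
    and regular: "\<And>v. v \<in> carrier_vec n \<Longrightarrow> \<exists>!r. r \<in> R \<and> row r 0 = vCons 1 v"
    using assms(1) by (auto simp: regular_subgroup_def)
  have AGL_D: "A \<in> carrier_mat d d" "col A 0 = ?e" if "A \<in> carrier (AGL n)" for A :: "'a mat"
    using that GL_carrier_mat[of A d] by (auto simp: AGL_def d_def)
  have R_AGL: "r \<in> carrier (AGL n)" if "r \<in> R" for r using subgroup.mem_carrier[OF sub that] .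
  have z: "z \<in> R" and central: "\<And>r. r \<in> R \<Longrightarrow> z * r = r * z"
    using assms(2) by (auto simp: center_def AGL_simps)
  have zm: "z \<in> carrier_mat d d" using AGL_D R_AGL z by blast
  define N where "N = z - 1\<^sub>m d"
  have N: "N \<in> carrier_mat d d" using zm by (simp add: N_def minus_carrier_mat)
  have zN: "z = 1\<^sub>m d + N" using zm by (intro eq_matI) (auto simp: N_def)
  have NT: "N\<^sup>T \<in> carrier_mat d d" using N by simp
  let ?S = "transpose_mat ` R"
  have S: "s \<in> carrier_mat d d" if "s \<in> ?S" for s using that AGL_D R_AGL by auto
  have S_inv: "\<exists>t \<in> carrier_mat d d. t * s = 1\<^sub>m d" if sS: "s \<in> ?S" for s
  proof -
    obtain r where r: "r \<in> R" "s = r\<^sup>T" using sS by blast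
    note rG = R_AGL[OF r(1)]
    have rm: "r \<in> carrier_mat d d" and im: "inv\<^bsub>AGL n\<^esub> r \<in> carrier_mat d d"
      using AGL_D(1) rG inv_closed by auto
    have "r * inv\<^bsub>AGL n\<^esub> r = 1\<^sub>m d" using r_inv[OF rG] by (simp add: AGL_simps d_def)
    then have "(inv\<^bsub>AGL n\<^esub> r)\<^sup>T * s = 1\<^sub>m d"
      using transpose_mult[OF rm im] by (simp add: r(2))
    then show ?thesis using im by (intro bexI[of _ "(inv\<^bsub>AGL n\<^esub> r)\<^sup>T"]) auto
  qed
  have S_commute: "N\<^sup>T * s = s * N\<^sup>T" if sS: "s \<in> ?S" for s
  proof -
    obtain r where r: "r \<in> R" "s = r\<^sup>T" using sS by blast
    have rm: "r \<in> carrier_mat d d" using AGL_D(1) R_AGL[OF r(1)] by auto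
    have "r * N = N * r"
      using central[OF r(1)] rm zm
      by (simp add: N_def mult_minus_distrib_mat[of _ d d _ d] minus_mult_distrib_mat[of _ d d _ _ d])
    then show ?thesis using transpose_mult[OF rm N] transpose_mult[OF N rm] r(2) by simp
  qed
  have S_transitive: "\<exists>s \<in> ?S. s *\<^sub>v ?e = x" if x: "x \<in> carrier_vec d" "x $ 0 = 1" for x
  proof -
    define v where "v = vec n (\<lambda>i. x $ Suc i)"
    have "x = vCons 1 v"
      using x by (intro eq_vecI) (auto simp: v_def d_def vec_index_vCons)
    moreover obtain r where r: "r \<in> R" "row r 0 = vCons 1 v"
      using regular[of v] by (auto simp: v_def)
    moreover have "r \<in> carrier_mat d d" using AGL_D(1) R_AGL[OF r(1)] by auto
    ultimately show ?thesis
      using d by (intro bexI[of _ "r\<^sup>T"]) (auto simp: mult_mat_vec_unit[of _ d d])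
  qed
  \<comment> \<open>Membership of \<open>z\<close> in \<open>AGL n\<close> says that column 0 of
    \<open>z\<close> is \<open>e\<close>, that is, \<open>N e = 0\<close>.\<close>
  have row0: "row (N\<^sup>T) 0 = 0\<^sub>v d"
    using AGL_D(2)[OF R_AGL[OF z]] zm d by (auto simp: N_def vec_eq_iff)
  have "\<exists>k. N\<^sup>T ^\<^sub>m k = 0\<^sub>m d d"
    by (rule nilpotent_if_transitive_commutant[where S = ?S and d = d and M = "N\<^sup>T"]; fact)
  then obtain k where "(N ^\<^sub>m k)\<^sup>T = 0\<^sub>m d d" using transpose_pow_mat[OF N] by metis
  then have "N ^\<^sub>m k = 0\<^sub>m d d" by (metis transpose_transpose zero_transpose_mat)
  \<comment> \<open>Here \<open>p0\<close> and \<open>w0\<close> only witness that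
    \<open>N^(m-1)\<close> is nonzero; the vector that starts the Jordan basis is constructed
    below.\<close>
  then obtain m p0 w0 where m: "0 < m" and nil: "N ^\<^sub>m m = 0\<^sub>m d d"
    and pw: "p0 \<in> carrier_vec d" "w0 \<bullet> (N ^\<^sub>m (m - 1) *\<^sub>v p0) = 1" "w0 \<in> carrier_vec d"
    using nilpotency_index_exists[OF N _ d] by metis
  define K where "K = N ^\<^sub>m (m - 1)"
  have K: "K \<in> carrier_mat d d" using N by (simp add: K_def)
  have KT_pow: "K\<^sup>T = N\<^sup>T ^\<^sub>m (m - 1)" by (simp add: K_def transpose_pow_mat[OF N])
  have K_neq: "K\<^sup>T \<noteq> 0\<^sub>m d d"
  proof
    assume "K\<^sup>T = 0\<^sub>m d d"
    then have "K = 0\<^sub>m d d" by (metis transpose_transpose zero_transpose_mat)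
    then have "K *\<^sub>v p0 = 0\<^sub>v d" using pw(1) by (intro eq_vecI) auto
    then have "w0 \<bullet> (K *\<^sub>v p0) = 0" using pw(3) by simp
    then show False using pw(2) by (simp add: K_def)
  qed
  have kernel: "x $ 0 = 0" if x: "x \<in> carrier_vec d" and kills: "K\<^sup>T *\<^sub>v x = 0\<^sub>v d" for x
  proof (rule ccontr)
    assume x0: "x $ 0 \<noteq> 0"
    note kills' = kills[unfolded KT_pow]
    have "K\<^sup>T = 0\<^sub>m d d"
      unfolding KT_pow
      by (rule pow_eq_zero_if_kills_vec[where S = ?S and d = d and M = "N\<^sup>T" and x = x]; fact)
    then show False using K_neq by simp
  qed
  obtain L where L: "L \<in> carrier_mat d d" and KLK: "K * L * K = K"
    using generalized_inverse_exists[OF K] by blast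
  have KT: "K\<^sup>T \<in> carrier_mat d d" and LT: "L\<^sup>T \<in> carrier_mat d d" using K L by auto
  have KLKT: "K\<^sup>T * (L\<^sup>T * K\<^sup>T) = K\<^sup>T"
    using KLK K L by (metis mult_carrier_mat transpose_mult)
  \<comment> \<open>The columns of \<open>U\<close> lie in the kernel of \<open>K\<^sup>T\<close>,
    so by \<open>kernel\<close> its row 0 vanishes. Read in the transpose \<open>1 - K * L\<close>,
    this says \<open>K L e = e\<close>.\<close>
  define U where "U = 1\<^sub>m d - L\<^sup>T * K\<^sup>T"
  have U: "U \<in> carrier_mat d d" using L K by (simp add: U_def minus_carrier_mat)
  have KU: "K\<^sup>T * U = 0\<^sub>m d d"
    using KLKT KT LT by (simp add: U_def mult_minus_distrib_mat[of _ d d _ d])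
  have U0: "U $$ (0, j) = 0" if j: "j < d" for j
  proof -
    have "K\<^sup>T *\<^sub>v col U j = col (K\<^sup>T * U) j" using KT U j by (intro eq_vecI) auto
    also have "\<dots> = 0\<^sub>v d" using j by (simp add: KU)
    finally have "col U j $ 0 = 0" by (rule kernel[rotated]) (use U j in simp)
    then show ?thesis using U d j by simp
  qed
  define p where "p = col L 0"
  have p: "p \<in> carrier_vec d" using L d by (simp add: p_def)
  have Kp: "K *\<^sub>v p = ?e"
  proof (rule eq_vecI)
    fix j assume "j < dim_vec ?e"
    then have j: "j < d" by simp
    have "(K *\<^sub>v p) $ j = (K * L)\<^sup>T $$ (0, j)" using K L j d by (simp add: p_def)
    also have "\<dots> = (L\<^sup>T * K\<^sup>T) $$ (0, j)" by (simp add: transpose_mult[OF K L])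
    also have "\<dots> = ?e $ j" using U0[OF j] j d LT KT by (simp add: U_def split: if_splits)
    finally show "(K *\<^sub>v p) $ j = ?e $ j" .
  qed (use K in simp)
  have "?e \<bullet> (N ^\<^sub>m (m - 1) *\<^sub>v p) = 1" using Kp d by (simp add: K_def)
  from nilpotent_jordan_form[OF N nil m p unit_vec_carrier this]
  obtain ns P Q where ns: "sorted_wrt (\<ge>) ns" "\<forall>k \<in> set ns. 0 < k \<and> k \<le> m" "sum_list ns = d"
    and wit: "similar_mat_wit N (jordan_matrix (map (\<lambda>k. (k, 0)) ns)) P Q"
    and Qe: "Q *\<^sub>v ?e = ?e"
    using Kp unfolding K_def by metis
  note w = similar_mat_witD2[OF N wit]
  note P = w(6) and Q = w(7)
  let ?J = "jordan_matrix (map (\<lambda>k. (k, 1)) ns) :: 'a mat"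
  let ?Jnil = "jordan_matrix (map (\<lambda>k. (k, 0)) ns) :: 'a mat"
  have J: "?J = 1\<^sub>m d + ?Jnil" by (simp add: jordan_matrix_1_eq ns(3))
  have Jm: "?J \<in> carrier_mat d d" using w(5) by (simp add: J)
  have "P * ?J = P + P * ?Jnil"
    unfolding J using P w(5) by (simp add: mult_add_distrib_mat[OF P _ w(5)])
  then have zPQ: "z = P * ?J * Q"
    using add_mult_distrib_mat[of P d d "P * ?Jnil" Q d] P Q w(1,3,5) by (simp add: zN)
  have wit_z: "similar_mat_wit z ?J P Q"
    by (rule similar_mat_witI[OF w(1,2) zPQ zm Jm P Q])
  \<comment> \<open>Fixing \<open>e\<close> from the left means having \<open>e\<close> as column 0,
    so \<open>P\<close> and its inverse \<open>Q\<close> are affine and \<open>P\<close> is the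
    required conjugator.\<close>
  have Pe: "P *\<^sub>v ?e = ?e"
    using assoc_mult_mat_vec[OF P Q unit_vec_carrier, of 0] w(1) Qe by simp
  have in_AGL: "A \<in> carrier (AGL n)"
    if "A \<in> carrier_mat d d" "B \<in> carrier_mat d d" "A * B = 1\<^sub>m d" "B * A = 1\<^sub>m d" "A *\<^sub>v ?e = ?e"
    for A B :: "'a mat"
    using that mult_mat_vec_unit[of A d d 0] d
    by (auto simp: AGL_def GL_def units_of_def Units_def ring_mat_simps d_def)
  have PG: "P \<in> carrier (AGL n)" by (rule in_AGL[OF P Q w(1,2) Pe])
  have QG: "Q \<in> carrier (AGL n)" by (rule in_AGL[OF Q P w(2,1) Qe])
  have "inv\<^bsub>AGL n\<^esub> P = Q"
    by (rule inv_equality[OF _ PG QG]) (use w(2) in \<open>simp add: AGL_simps d_def\<close>)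
  moreover have "Q * z * P = ?J"
    using similar_mat_witD2(3)[OF Jm similar_mat_wit_sym[OF wit_z]] by simp
  ultimately have "inv\<^bsub>AGL n\<^esub> P \<otimes>\<^bsub>AGL n\<^esub> z \<otimes>\<^bsub>AGL n\<^esub> P = unipotent_jordan_matrix ns"
    by (simp add: AGL_simps unipotent_jordan_matrix_def)
  moreover have "unipotent_jordan_form z ns"
    using ns wit_z by (auto simp: unipotent_jordan_form_def jordan_nf_def similar_mat_def)
  ultimately show ?thesis using PG by blast
qed

end
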